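(* Let $N=2n$ and $M=2m$ be positive even integers with $N$ a multiple of $8$. Let $\mathbf A=(a_{k_1,k_2})_{k_1=-n,k_2=-m}^{n-1,m-1}\in\mathbb C^{N\times M}$ and let $\hat{\mathbf A}=(\hat a_{\nu_1,\nu_2})_{\nu_1=-n,\nu_2=-m}^{n-1,m-1}=\mathbf F_N\mathbf A\mathbf F_M$ be its 2D discrete Fourier transform. Assume that half of the Fourier data, namely $$\hat a_{2\nu_1+1,\nu_2},\qquad \nu_1=-\tfrac n2,\dots,\tfrac n2-1,\ \nu_2=-m,\dots,m-1,$$ are acquired (given). Let $\mathbf W=(\mathsf w_{\nu_1,\nu_2})_{\nu_1=-n/2,\nu_2=-m}^{n/2-1,m-1}\in\mathbb C^{n\times M}$ be a matrix of arbitrary complex weights, extended periodically by $\mathsf w_{\nu_1+\ell_1 n,\nu_2+\ell_2 M}=\mathsf w_{\nu_1,\nu_2}$ for all $\ell_1,\ell_2\in\mathbb Z$, and let $\check{\mathbf W}=(\check{\mathsf w}_{k_1,k_2})=\sqrt{Mn}\,\mathbf F_n^{-1}\mathbf W\mathbf F_M^{-1}$. Define $\hat{\tilde{\mathbf A}}=(\hat{\tilde a}_{\nu_1,\nu_2})_{\nu_1=-n,\nu_2=-m}^{n-1,m-1}$ by the interpolation scheme $$\hat{\tilde a}_{2\nu_1+1,\nu_2}:=\hat a_{2\nu_1+1,\nu_2},\qquad \hat{\tilde a}_{2\nu_1,\nu_2}:=\sum_{\ell_1=-n/2}^{n/2-1}\ \sum_{\ell_2=-m}^{m-1}\mathsf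 w_{\nu_1-\ell_1,\nu_2-\ell_2}\,\hat a_{2\ell_1+1,\ell_2}$$ for $\nu_1=-\frac n2,\dots,\frac n2-1$, $\nu_2=-m,\dots,m-1$. Then the image approximation $\tilde{\mathbf A}=(\tilde a_{k_1,k_2})_{k_1=-n,k_2=-m}^{n-1,m-1}:=\mathbf F_N^{-1}\hat{\tilde{\mathbf A}}\mathbf F_M^{-1}$ satisfies $$\tilde a_{k_1,k_2}=\tfrac12\bigl(1+\check{\mathsf w}_{k_1,k_2}\,\omega_N^{k_1}\bigr)\bigl(a_{k_1,k_2}-a_{k_1-n,k_2}\bigr)$$ for all $k_1=0,\dots,n-1$, $k_2=-m,\dots,m-1$.
   Context: For a positive even integer $P$, $\omega_P:=e^{-2\pi \mathrm i/P}$ and $\mathbf F_P:=\frac1{\sqrt P}(\omega_P^{jk})_{j,k=-P/2}^{P/2-1}$ denotes the centered unitary Fourier matrix, so $\mathbf F_P^{-1}=\overline{\mathbf F}_P$. Rows and columns of matrices are indexed by the centered index sets, i.e. $\{-n,\dots,n-1\}$ for length $N=2n$, $\{-m,\dots,m-1\}$ for length $M=2m$, and $\{-\frac n2,\dots,\frac n2-1\}$ for length $n$. Componentwise, $\hat a_{\nu_1,\nu_2}=\frac1{\sqrt{MN}}\sum_{k_1=-n}^{n-1}\sum_{k_2=-m}^{m-1}a_{k_1,k_2}\omega_N^{k_1\nu_1}\omega_M^{k_2\nu_2}$, and $\check{\mathsf w}_{k_1,k_2}=\sum_{\nu_1=-n/2}^{n/2-1}\sum_{\nu_2=-m}^{m-1}\mathsf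 w_{\nu_1,\nu_2}\,\omega_n^{-k_1\nu_1}\omega_M^{-k_2\nu_2}$; the latter is understood for all integers $k_1$, i.e. $\check{\mathsf w}_{k_1,k_2}$ is extended $n$-periodically in $k_1$ from $\{-\frac n2,\dots,\frac n2-1\}$. *)

theory Defs
  imports "HOL-Analysis.Complex_Transcendental" "Jordan_Normal_Form.Determinant"
    "Jordan_Normal_Form.Gauss_Jordan_Elimination"
begin

text \<open>
  Matrices are indexed from 0. The centered indexing
  of a matrix with \<open>nr\<close> rows and \<open>nc\<close> columns (both even) shifts these indices, so that rows run
  over \<open>-nr/2, ..., nr/2 - 1\<close> and columns over \<open>-nc/2, ..., nc/2 - 1\<close>.
  Since \<open>nat\<close> truncates, \<open>centry\<close> is meaningful only for indices in these ranges.
\<close>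

definition cmat :: "nat \<Rightarrow> nat \<Rightarrow> (int \<Rightarrow> int \<Rightarrow> 'a) \<Rightarrow> 'a mat" where
  "cmat nr nc f = mat nr nc (\<lambda>(i, j). f (int i - int nr div 2) (int j - int nc div 2))"

definition centry :: "'a mat \<Rightarrow> int \<Rightarrow> int \<Rightarrow> 'a" where
  "centry A i j =
     A $$ (nat (i + int (dim_row A) div 2), nat (j + int (dim_col A) div 2))"

text \<open>
  Periodic extension of the centered entries to all integer indices, with period the number of rows
  in the first index and the number of columns in the second.
\<close>

definition pentry :: "'a mat \<Rightarrow> int \<Rightarrow> int \<Rightarrow> 'a" where
  "pentry A i j =
     A $$ (nat ((i + int (dim_row A) div 2) mod int (dim_row A)),
           nat ((j + int (dim_col A) div 2) mod int (dim_col A)))"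

definition omega :: "nat \<Rightarrow> complex" where
  "omega P = exp (- (2 * of_real pi * \<i> / of_nat P))"

definition fourier :: "nat \<Rightarrow> complex mat" where
  "fourier P = cmat P P (\<lambda>j k. omega P powi (j * k) / of_real (sqrt (real P)))"

text \<open>
  \<open>mat_inverse\<close> returns an option; \<open>mat_inverse_fourier\<close> below shows that it is defined here and
  equals the entrywise conjugate.
\<close>

definition fourier_inv :: "nat \<Rightarrow> complex mat" where
  "fourier_inv P = the (mat_inverse (fourier P))"

lemma centry_cmat:
  assumes "even nr" "even nc"
    and "i \<in> {- (int nr div 2)..<int nr div 2}" "j \<in> {- (int nc div 2)..<int nc div 2}"
  shows "centry (cmat nr nc f) i j = f i j"
  using assms by (auto simp: centry_def cmat_def elim!: evenE)

lemma pentry_eq_centry: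
  assumes "A \<in> carrier_mat nr nc" "even nr" "even nc"
    and "i \<in> {- (int nr div 2)..<int nr div 2}" "j \<in> {- (int nc div 2)..<int nc div 2}"
  shows "pentry A i j = centry A i j"
  using assms by (auto simp: centry_def pentry_def elim!: evenE)

lemma pentry_periodic:
  assumes "A \<in> carrier_mat nr nc"
  shows "pentry A (i + l1 * int nr) (j + l2 * int nc) = pentry A i j"
proof -
  have "(x + l * p + y) mod p = (x + y) mod p" for x y l p :: int
    by (metis add.assoc add.commute mod_mult_self1)
  then show ?thesis
    using assms by (simp add: pentry_def)
qed

lemma omega_nonzero [simp]: "omega P \<noteq> 0"
  by (simp add: omega_def)

lemma cnj_omega_powi: "cnj (omega P powi k) = omega P powi (- k)"
proof -
  have "cnj (omega P) = inverse (omega P)"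
    by (simp add: omega_def exp_cnj exp_minus)
  then show ?thesis
    by (simp add: power_int_minus flip: power_int_inverse)
qed

lemma omega_powi_eq_1_iff:
  assumes "P > 0"
  shows "omega P powi d = 1 \<longleftrightarrow> int P dvd d"
proof -
  have "omega P powi d = exp (of_int d * - (2 * of_real pi * \<i> / of_nat P))"
    unfolding omega_def by (simp add: exp_power_int mult.commute)
  also have "\<dots> = 1 \<longleftrightarrow> (\<exists>n::int. - (real_of_int d * (2 * pi) / real P) = of_int (2 * n) * pi)"
    by (simp add: exp_eq_1 Re_divide_of_nat Im_divide_of_nat)
  also have "\<dots> \<longleftrightarrow> (\<exists>n::int. - real_of_int d = of_int n * real P)"
  proof -
    have "- (real_of_int d * (2 * pi) / real P) = of_int (2 * n) * pi \<longleftrightarrow>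
          pi * (- real_of_int d) = pi * (of_int n * real P)" for n
      using assms by (simp add: field_simps)
    then show ?thesis by (simp only: mult_cancel_left pi_neq_zero simp_thms)
  qed
  also have "\<dots> \<longleftrightarrow> (\<exists>n::int. - d = n * int P)"
    by (simp flip: of_int_eq_iff[where ?'a = real])
  also have "\<dots> \<longleftrightarrow> int P dvd d"
    by (metis dvd_def dvd_minus_iff mult.commute)
  finally show ?thesis .
qed

lemma fourier_times_conj:
  assumes P: "P > 0"
  shows "fourier P * map_mat cnj (fourier P) = 1\<^sub>m P"
proof (rule eq_matI)
  fix i j assume ij: "i < dim_row (1\<^sub>m P)" "j < dim_col (1\<^sub>m P)"
  define h where "h = int P div 2"
  define z where "z = omega P powi (int i - int j)"
  have sq: "complex_of_real (sqrt (real P)) * complex_of_real (sqrt (real P)) = of_nat P"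
    by (simp flip: of_real_mult)
  have tm: "omega P powi ((int i - h) * (int k - h)) * omega P powi (- ((int k - h) * (int j - h)))
      = z powi (- h) * z ^ k" for k
  proof -
    have "omega P powi ((int i - h) * (int k - h)) * omega P powi (- ((int k - h) * (int j - h)))
      = omega P powi ((int i - int j) * (- h) + (int i - int j) * int k)"
      by (simp flip: power_int_add add: algebra_simps)
    also have "\<dots> = z powi (- h) * z powi (int k)"
      unfolding z_def by (subst power_int_add) (simp_all only: power_int_mult omega_nonzero simp_thms)
    finally show ?thesis by simp
  qed
  have "(fourier P * map_mat cnj (fourier P)) $$ (i, j) =
     (\<Sum>k<P. omega P powi ((int i - h) * (int k - h)) / of_real (sqrt (real P)) *
        (omega P powi (- ((int k - h) * (int j - h))) / of_real (sqrt (real P))))"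
    using ij by (simp add: fourier_def cmat_def scalar_prod_def h_def lessThan_atLeast0 flip: cnj_omega_powi)
  also have "\<dots> = (\<Sum>k<P. z powi (- h) * z ^ k / of_nat P)"
    by (simp only: times_divide_times_eq sq tm)
  also have "\<dots> = z powi (- h) / of_nat P * (\<Sum>k<P. z ^ k)"
    by (simp add: sum_distrib_left)
  also have "\<dots> = 1\<^sub>m P $$ (i, j)"
  proof (cases "i = j")
    case True
    then show ?thesis using ij P by (simp add: z_def)
  next
    case False
    have "z \<noteq> 1"
      using False ij zdvd_imp_le[of "int P" "\<bar>int i - int j\<bar>"]
      by (auto simp: z_def omega_powi_eq_1_iff[OF P])
    moreover have "z ^ P = 1"
    proof -
      have "z ^ P = omega P powi ((int i - int j) * int P)"
        by (simp add: z_def power_int_mult)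
      then show ?thesis by (simp add: omega_powi_eq_1_iff[OF P])
    qed
    ultimately show ?thesis using False ij by (simp add: geometric_sum)
  qed
  finally show "(fourier P * map_mat cnj (fourier P)) $$ (i, j) = 1\<^sub>m P $$ (i, j)" .
qed (simp_all add: fourier_def cmat_def)

lemma mat_inverse_fourier:
  assumes P: "P > 0"
  shows "mat_inverse (fourier P) = Some (map_mat cnj (fourier P))"
proof -
  let ?F = "fourier P" and ?G = "map_mat cnj (fourier P)"
  have F: "?F \<in> carrier_mat P P" and G: "?G \<in> carrier_mat P P"
    by (simp_all add: fourier_def cmat_def)
  have FG: "?F * ?G = 1\<^sub>m P" by (rule fourier_times_conj[OF P])
  have GF: "?G * ?F = 1\<^sub>m P" by (rule mat_mult_left_right_inverse[OF F G FG])
  have "?F \<in> Units (ring_mat TYPE(complex) P b)" for b :: nat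
    using F G FG GF by (auto simp: Units_def ring_mat_def)
  then obtain B where B: "mat_inverse ?F = Some B"
    using mat_inverse(1)[OF F, of "0 :: nat"] by (cases "mat_inverse ?F") auto
  with mat_inverse(2)[OF F B] have "B * ?F = 1\<^sub>m P" "B \<in> carrier_mat P P" by auto
  then have "B = ?G"
    using F G FG assoc_mult_mat[of B P P ?F P ?G P] by simp
  with B show ?thesis by simp
qed

lemma fourier_inv_eq: "P > 0 \<Longrightarrow> fourier_inv P = map_mat cnj (fourier P)"
  by (simp add: fourier_inv_def mat_inverse_fourier)

end

theory Submission
  imports Defs
begin

text \<open>
  The original image is the inverse transform of its own Fourier data, so both \<open>A\<close> and its
  approximation are sums of characters \<open>omega N powi (-k1 * \<nu>1) * omega M powi (-k2 * \<nu>2)\<close>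
  (\<open>centry_idft2\<close>), and no forward transform ever has to be expanded.

  Moving \<open>k1\<close> by \<open>n = N / 2\<close> multiplies the character by \<open>(-1)\<close> to the power \<open>\<nu>1\<close>.  Hence the
  difference \<open>a(k1, k2) - a(k1 - n, k2)\<close> keeps only the odd rows of the Fourier data, and keeps them
  with weight 2 (\<open>halfperiod_difference\<close>): the contribution of the acquired rows to the
  approximation is half of that difference.

  The interpolated even rows are a cyclic convolution of the weights with the acquired rows.  On even
  rows the character for \<open>N\<close> is a character for \<open>n\<close>, so by the convolution theorem
  (\<open>convolution_theorem\<close>) their contribution is the product of the transformed weights and the
  character sum \<open>\<Sum>\<nu>. ah (2 * \<nu>1 + 1, \<nu>2) * omega n powi (-k1 * \<nu>1) * omega M powi (-k2 * \<nu>2)\<close>.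
  That sum differs from the contribution of the odd rows only by the factor \<open>omega N powi k1\<close>,
  because the rows sit at \<open>2 * \<nu>1 + 1\<close> and not at \<open>2 * \<nu>1\<close>.  Adding both contributions gives the
  factor \<open>1 + wc(k1, k2) * omega N powi k1\<close>.
\<close>

section \<open>Centered index ranges\<close>

abbreviation centered :: "nat \<Rightarrow> int set" where
  "centered P \<equiv> {- (int P div 2)..<int P div 2}"

definition centered_rep :: "nat \<Rightarrow> int \<Rightarrow> int" where
  "centered_rep P x = (x + int P div 2) mod int P - int P div 2"

lemma centered_rep_in:
  assumes "even P" "P > 0"
  shows "centered_rep P x \<in> centered P"
proof -
  have "0 \<le> (x + int P div 2) mod int P" "(x + int P div 2) mod int P < int P"
    using assms(2) by simp_all
  moreover have "int P = 2 * (int P div 2)" using assms(1) by simp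
  ultimately show ?thesis unfolding centered_rep_def by auto
qed

lemma centered_rep_id:
  assumes "even P" "x \<in> centered P"
  shows "centered_rep P x = x"
proof -
  have "int P = 2 * (int P div 2)" using assms(1) by simp
  with assms(2) have "0 \<le> x + int P div 2" "x + int P div 2 < int P" by auto
  then show ?thesis by (simp add: centered_rep_def)
qed

lemma centered_rep_cong: "\<exists>l. centered_rep P x = x + l * int P"
proof
  show "centered_rep P x = x + - ((x + int P div 2) div int P) * int P"
    using div_mult_mod_eq[of "x + int P div 2" "int P"] unfolding centered_rep_def by linarith
qed

lemma centered_rep_shift: "centered_rep P (x + l * int P) = centered_rep P x"
proof -
  have "x + l * int P + int P div 2 = (x + int P div 2) + l * int P" by simp
  then show ?thesis unfolding centered_rep_def by (simp only: mod_mult_self1)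
qed

lemma pentry_eq_centry_rep:
  "pentry A i j = centry A (centered_rep (dim_row A) i) (centered_rep (dim_col A) j)"
  by (simp add: pentry_def centry_def centered_rep_def)

text \<open>Reducing to centered representatives permutes every translate of a full period.\<close>

lemma sum_centered_shift:
  fixes f :: "int \<Rightarrow> 'a::comm_monoid_add"
  assumes "even P" "P > 0" and per: "\<And>x l. f (x + l * int P) = f x"
  shows "(\<Sum>\<nu>\<in>centered P. f (\<nu> - s)) = sum f (centered P)"
proof (rule sum.reindex_bij_witness[where i = "\<lambda>\<mu>. centered_rep P (\<mu> + s)"
      and j = "\<lambda>\<nu>. centered_rep P (\<nu> - s)"])
  fix \<nu> assume \<nu>: "\<nu> \<in> centered P"
  obtain l where l: "centered_rep P (\<nu> - s) = \<nu> - s + l * int P"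
    using centered_rep_cong by blast
  show "f (centered_rep P (\<nu> - s)) = f (\<nu> - s)" by (simp add: l per)
  have "centered_rep P (centered_rep P (\<nu> - s) + s) = centered_rep P (\<nu> + l * int P)"
    by (simp add: l algebra_simps)
  then show "centered_rep P (centered_rep P (\<nu> - s) + s) = \<nu>"
    using assms \<nu> by (simp only: centered_rep_shift centered_rep_id)
next
  fix \<mu> assume \<mu>: "\<mu> \<in> centered P"
  obtain l where l: "centered_rep P (\<mu> + s) = \<mu> + s + l * int P"
    using centered_rep_cong by blast
  have "centered_rep P (centered_rep P (\<mu> + s) - s) = centered_rep P (\<mu> + l * int P)"
    by (simp add: l algebra_simps)
  then show "centered_rep P (centered_rep P (\<mu> + s) - s) = \<mu>"
    using assms \<mu> by (simp only: centered_rep_shift centered_rep_id)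
qed (use assms centered_rep_in in blast)+

lemma sum_centered_even_odd:
  fixes f :: "int \<Rightarrow> 'a::comm_monoid_add"
  assumes "even n"
  shows "sum f (centered (2 * n)) = (\<Sum>\<nu>\<in>centered n. f (2 * \<nu>)) + (\<Sum>\<nu>\<in>centered n. f (2 * \<nu> + 1))"
proof -
  obtain h where n: "n = 2 * h" using assms by blast
  let ?E = "(\<lambda>\<nu>. 2 * \<nu>) ` centered n" and ?O = "(\<lambda>\<nu>. 2 * \<nu> + 1) ` centered n"
  have "centered (2 * n) = ?E \<union> ?O"
  proof (intro equalityI subsetI)
    fix x assume x: "x \<in> centered (2 * n)"
    show "x \<in> ?E \<union> ?O"
    proof (cases "even x")
      case True
      then obtain y where y: "x = 2 * y" by blast
      with x n have "y \<in> centered n" by auto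
      with y show ?thesis by blast
    next
      case False
      then obtain y where y: "x = 2 * y + 1" by (blast elim: oddE)
      with x n have "y \<in> centered n" by auto
      with y show ?thesis by blast
    qed
  qed (auto simp: n)
  moreover have "?E \<inter> ?O = {}"
  proof -
    have "2 * a \<noteq> 2 * b + 1" for a b :: int by presburger
    then show ?thesis by blast
  qed
  ultimately have "sum f (centered (2 * n)) = sum f ?E + sum f ?O"
    by (simp only: sum.union_disjoint finite_imageI finite_atLeastLessThan_int)
  also have "sum f ?E = (\<Sum>\<nu>\<in>centered n. f (2 * \<nu>))"
    by (subst sum.reindex) (auto simp: inj_on_def)
  also have "sum f ?O = (\<Sum>\<nu>\<in>centered n. f (2 * \<nu> + 1))"
    by (subst sum.reindex) (auto simp: inj_on_def)
  finally show ?thesis .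
qed

section \<open>Characters\<close>

lemma omega_powi_period:
  assumes "P > 0"
  shows "omega P powi (x + l * int P) = omega P powi x"
  by (simp add: power_int_add omega_powi_eq_1_iff[OF assms])

lemma omega_powi_centered_rep:
  assumes "P > 0"
  shows "omega P powi (- (centered_rep P k * \<nu>)) = omega P powi (- (k * \<nu>))"
proof -
  obtain l where l: "centered_rep P k = k + l * int P" using centered_rep_cong by blast
  have "- ((k + l * int P) * \<nu>) = - (k * \<nu>) + (- l * \<nu>) * int P"
    by (simp add: algebra_simps)
  then show ?thesis unfolding l by (simp only: omega_powi_period[OF assms])
qed

lemma omega_double_powi_even:
  assumes "n > 0"
  shows "omega (2 * n) powi (2 * x) = omega n powi x"
proof -
  have "omega (2 * n) ^ 2 = omega n"
    using assms by (simp only: omega_def flip: exp_double) (simp, simp only: mult.assoc)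
  then have "omega (2 * n) powi 2 = omega n" by simp
  then show ?thesis by (simp only: power_int_mult)
qed

text \<open>
  \<open>omega (2 * n)\<close> to the power \<open>n\<close> is a square root of 1 other than 1.
\<close>

lemma omega_double_powi_half:
  assumes "n > 0"
  shows "omega (2 * n) powi int n = - 1"
proof -
  have N: "2 * n > 0" using assms by simp
  have "omega (2 * n) powi int n \<noteq> 1"
    unfolding omega_powi_eq_1_iff[OF N] using assms zdvd_imp_le[of "int (2 * n)" "int n"] by auto
  moreover have "(omega (2 * n) powi int n)\<^sup>2 = omega (2 * n) powi (2 * int n)"
    by (simp only: mult_2 power2_eq_square power_int_add omega_nonzero simp_thms)
  then have "(omega (2 * n) powi int n)\<^sup>2 = 1"
    using assms by (simp add: omega_powi_eq_1_iff)
  ultimately show ?thesis by (simp add: power2_eq_1_iff)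
qed

section \<open>The inverse transform as a character sum\<close>

lemma centry_mult:
  fixes A B :: "complex mat"
  assumes A: "A \<in> carrier_mat a b" and B: "B \<in> carrier_mat b c"
    and ev: "even a" "even b" "even c" and i: "i \<in> centered a" and j: "j \<in> centered c"
  shows "centry (A * B) i j = (\<Sum>l\<in>centered b. centry A i l * centry B l j)"
proof -
  have b: "int b = 2 * (int b div 2)" and a: "int a = 2 * (int a div 2)"
    and c: "int c = 2 * (int c div 2)" using ev by simp_all
  have ii: "nat (i + int a div 2) < a" using i a by auto
  have jj: "nat (j + int c div 2) < c" using j c by auto
  have "centry (A * B) i j =
     (\<Sum>k<b. A $$ (nat (i + int a div 2), k) * B $$ (k, nat (j + int c div 2)))"
    using A B ii jj by (simp add: centry_def scalar_prod_def lessThan_atLeast0)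
  also have "\<dots> = (\<Sum>l\<in>centered b. centry A i l * centry B l j)"
    using A B b by (intro sum.reindex_bij_witness[where i = "\<lambda>l. nat (l + int b div 2)"
          and j = "\<lambda>k. int k - int b div 2"]) (auto simp: centry_def)
  finally show ?thesis .
qed

lemma fourier_carrier [simp]: "fourier P \<in> carrier_mat P P"
  by (simp add: fourier_def cmat_def)

lemma fourier_inv_carrier: "P > 0 \<Longrightarrow> fourier_inv P \<in> carrier_mat P P"
  by (simp add: fourier_inv_eq)

lemma centry_fourier_inv:
  assumes "even P" "P > 0" "j \<in> centered P" "k \<in> centered P"
  shows "centry (fourier_inv P) j k = omega P powi (- (j * k)) / of_real (sqrt (real P))"
proof -
  have P: "int P = 2 * (int P div 2)" using assms(1) by simp
  have "centry (map_mat cnj (fourier P)) j k = cnj (centry (fourier P) j k)"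
    using assms P by (auto simp: centry_def fourier_def cmat_def)
  also have "\<dots> = omega P powi (- (j * k)) / of_real (sqrt (real P))"
    unfolding fourier_def by (subst centry_cmat) (use assms in \<open>auto simp: cnj_omega_powi simp del: complex_cnj_power_int\<close>)
  finally show ?thesis using assms(2) by (simp add: fourier_inv_eq)
qed

lemma centry_idft2:
  fixes X :: "complex mat"
  assumes P: "even P" "P > 0" and Q: "even Q" "Q > 0" and X: "X \<in> carrier_mat P Q"
    and k1: "k1 \<in> centered P" and k2: "k2 \<in> centered Q"
  shows "centry (fourier_inv P * X * fourier_inv Q) k1 k2 =
     (\<Sum>\<nu>1\<in>centered P. \<Sum>\<nu>2\<in>centered Q. centry X \<nu>1 \<nu>2 *
        (omega P powi (- (k1 * \<nu>1)) * omega Q powi (- (k2 * \<nu>2)))) / of_real (sqrt (real (P * Q)))"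
proof -
  note FP = fourier_inv_carrier[OF P(2)] and FQ = fourier_inv_carrier[OF Q(2)]
  have "centry (fourier_inv P * X * fourier_inv Q) k1 k2 =
     (\<Sum>\<nu>2\<in>centered Q. \<Sum>\<nu>1\<in>centered P. centry (fourier_inv P) k1 \<nu>1 * centry X \<nu>1 \<nu>2 *
         centry (fourier_inv Q) \<nu>2 k2)"
    by (subst centry_mult[OF mult_carrier_mat[OF FP X] FQ P(1) Q(1) Q(1) k1 k2])
      (auto simp: centry_mult[OF FP X P(1) P(1) Q(1) k1] sum_distrib_right intro!: sum.cong)
  also have "\<dots> = (\<Sum>\<nu>1\<in>centered P. \<Sum>\<nu>2\<in>centered Q. centry (fourier_inv P) k1 \<nu>1 *
         centry X \<nu>1 \<nu>2 * centry (fourier_inv Q) \<nu>2 k2)"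
    by (rule sum.swap)
  also have "\<dots> = (\<Sum>\<nu>1\<in>centered P. \<Sum>\<nu>2\<in>centered Q. centry X \<nu>1 \<nu>2 *
        (omega P powi (- (k1 * \<nu>1)) * omega Q powi (- (k2 * \<nu>2))) / of_real (sqrt (real (P * Q))))"
  proof (intro sum.cong refl)
    fix \<nu>1 \<nu>2 assume "\<nu>1 \<in> centered P" and "\<nu>2 \<in> centered Q"
    then show "centry (fourier_inv P) k1 \<nu>1 * centry X \<nu>1 \<nu>2 * centry (fourier_inv Q) \<nu>2 k2 =
      centry X \<nu>1 \<nu>2 * (omega P powi (- (k1 * \<nu>1)) * omega Q powi (- (k2 * \<nu>2)))
        / of_real (sqrt (real (P * Q)))"
      by (simp only: centry_fourier_inv[OF P k1] centry_fourier_inv[OF Q _ k2] mult.commute[of \<nu>2])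
        (simp add: real_sqrt_mult)
  qed
  finally show ?thesis by (simp add: sum_divide_distrib)
qed

text \<open>
  The normalization \<open>sqrt (P * Q)\<close> cancels the one of the unitary transforms.  The right-hand side
  is periodic in \<open>k1\<close> and \<open>k2\<close>, so the formula also covers the periodic extension.
\<close>

lemma pentry_unnormalized_idft2:
  fixes X :: "complex mat"
  assumes P: "even P" "P > 0" and Q: "even Q" "Q > 0" and X: "X \<in> carrier_mat P Q"
  shows "pentry (complex_of_real (sqrt (real (P * Q))) \<cdot>\<^sub>m (fourier_inv P * X * fourier_inv Q)) k1 k2 =
     (\<Sum>\<nu>1\<in>centered P. \<Sum>\<nu>2\<in>centered Q. centry X \<nu>1 \<nu>2 *
        (omega P powi (- (k1 * \<nu>1)) * omega Q powi (- (k2 * \<nu>2))))"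
proof -
  let ?F = "fourier_inv P * X * fourier_inv Q"
  let ?s = "complex_of_real (sqrt (real (P * Q)))"
  let ?k1 = "centered_rep P k1" and ?k2 = "centered_rep Q k2"
  have F: "?F \<in> carrier_mat P Q"
    using fourier_inv_carrier[OF P(2)] fourier_inv_carrier[OF Q(2)] X by simp
  have k1: "?k1 \<in> centered P" and k2: "?k2 \<in> centered Q"
    using P Q by (simp_all only: centered_rep_in)
  have eP: "int P = 2 * (int P div 2)" and eQ: "int Q = 2 * (int Q div 2)"
    using P Q by simp_all
  have "nat (?k1 + int P div 2) < P" "nat (?k2 + int Q div 2) < Q"
    using k1 k2 eP eQ by auto
  then have "pentry (?s \<cdot>\<^sub>m ?F) k1 k2 = ?s * centry ?F ?k1 ?k2"
    by (simp add: pentry_eq_centry_rep centry_def carrier_matD[OF F] del: index_mult_mat)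
  also have "\<dots> = (\<Sum>\<nu>1\<in>centered P. \<Sum>\<nu>2\<in>centered Q. centry X \<nu>1 \<nu>2 *
        (omega P powi (- (?k1 * \<nu>1)) * omega Q powi (- (?k2 * \<nu>2))))"
    unfolding centry_idft2[OF P Q X k1 k2] using P Q by simp
  finally show ?thesis by (simp only: omega_powi_centered_rep P Q)
qed

lemma idft2_dft2:
  assumes P: "P > 0" and Q: "Q > 0" and A: "A \<in> carrier_mat P Q"
  shows "fourier_inv P * (fourier P * A * fourier Q) * fourier_inv Q = A"
proof -
  note FP = fourier_carrier[of P] and FQ = fourier_carrier[of Q]
  note GP = fourier_inv_carrier[OF P] and GQ = fourier_inv_carrier[OF Q]
  have l: "fourier_inv P * fourier P = 1\<^sub>m P" and r: "fourier Q * fourier_inv Q = 1\<^sub>m Q"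
    using mat_mult_left_right_inverse[OF FP GP] fourier_times_conj[OF P] fourier_times_conj[OF Q] P Q
    by (simp_all add: fourier_inv_eq)
  have "fourier_inv P * (fourier P * A * fourier Q) * fourier_inv Q =
      fourier_inv P * ((fourier P * A * fourier Q) * fourier_inv Q)"
    by (rule assoc_mult_mat[OF GP mult_carrier_mat[OF mult_carrier_mat[OF FP A] FQ] GQ])
  also have "(fourier P * A * fourier Q) * fourier_inv Q = fourier P * A * (fourier Q * fourier_inv Q)"
    using A FP FQ GP GQ by (intro assoc_mult_mat) auto
  also have "\<dots> = fourier P * A" using A FP r by simp
  also have "fourier_inv P * (fourier P * A) = fourier_inv P * fourier P * A"
    using A FP GP by (intro assoc_mult_mat[symmetric]) auto
  also have "\<dots> = A" using l A by simp
  finally show ?thesis .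
qed

section \<open>Odd rows and interpolated rows\<close>

text \<open>
  A half-period shift leaves the characters of even rows unchanged and negates those of odd rows, so
  the even rows cancel in the difference and the odd rows double.
\<close>

lemma halfperiod_difference:
  fixes X :: "complex mat"
  assumes n: "even n" "n > 0" and Q: "even Q" "Q > 0" and X: "X \<in> carrier_mat (2 * n) Q"
    and k1: "k1 \<in> {0..<int n}" and k2: "k2 \<in> centered Q"
  defines "Y \<equiv> fourier_inv (2 * n) * X * fourier_inv Q"
  shows "centry Y k1 k2 - centry Y (k1 - int n) k2 =
     2 * (\<Sum>\<nu>1\<in>centered n. \<Sum>\<nu>2\<in>centered Q. centry X (2 * \<nu>1 + 1) \<nu>2 *
        (omega (2 * n) powi (- (k1 * (2 * \<nu>1 + 1))) * omega Q powi (- (k2 * \<nu>2))))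
     / of_real (sqrt (real (2 * n * Q)))"
proof -
  let ?w = "omega (2 * n)"
  define f where "f k \<nu>1 = (\<Sum>\<nu>2\<in>centered Q. centry X \<nu>1 \<nu>2 *
        (?w powi (- (k * \<nu>1)) * omega Q powi (- (k2 * \<nu>2))))" for k \<nu>1
  have N: "even (2 * n)" "2 * n > 0" using n by simp_all
  have Y: "centry Y k k2 = ((\<Sum>\<nu>\<in>centered n. f k (2 * \<nu>)) + (\<Sum>\<nu>\<in>centered n. f k (2 * \<nu> + 1)))
      / of_real (sqrt (real (2 * n * Q)))" if "k \<in> centered (2 * n)" for k
    unfolding Y_def centry_idft2[OF N Q X that k2] sum_centered_even_odd[OF n(1)] f_def ..
  have pe: "?w powi (- ((k1 - int n) * (2 * \<nu>))) = ?w powi (- (k1 * (2 * \<nu>)))" for \<nu>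
  proof -
    have "- ((k1 - int n) * (2 * \<nu>)) = - (k1 * (2 * \<nu>)) + \<nu> * int (2 * n)"
      by (simp add: algebra_simps)
    then show ?thesis by (simp only: omega_powi_period[OF N(2)])
  qed
  have po: "?w powi (- ((k1 - int n) * (2 * \<nu> + 1))) = - (?w powi (- (k1 * (2 * \<nu> + 1))))" for \<nu>
  proof -
    have "- ((k1 - int n) * (2 * \<nu> + 1)) = (- (k1 * (2 * \<nu> + 1)) + int n) + \<nu> * int (2 * n)"
      by (simp add: algebra_simps)
    then have "?w powi (- ((k1 - int n) * (2 * \<nu> + 1))) = ?w powi (- (k1 * (2 * \<nu> + 1)) + int n)"
      by (simp only: omega_powi_period[OF N(2)])
    then show ?thesis
      by (simp only: power_int_add omega_nonzero simp_thms omega_double_powi_half[OF n(2)]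
          mult_minus_right mult_1_right)
  qed
  have fe: "f (k1 - int n) (2 * \<nu>) = f k1 (2 * \<nu>)" for \<nu> unfolding f_def pe ..
  have fo: "f (k1 - int n) (2 * \<nu> + 1) = - f k1 (2 * \<nu> + 1)" for \<nu>
    unfolding f_def po by (simp add: sum_negf)
  have "k1 \<in> centered (2 * n)" "k1 - int n \<in> centered (2 * n)" using k1 by auto
  then have "centry Y k1 k2 - centry Y (k1 - int n) k2 =
      2 * (\<Sum>\<nu>\<in>centered n. f k1 (2 * \<nu> + 1)) / of_real (sqrt (real (2 * n * Q)))"
    by (simp only: Y fe fo sum_negf diff_divide_distrib[symmetric]) simp
  then show ?thesis unfolding f_def .
qed

text \<open>
  Periodicity turns the sum over the translated weights into the full sum, and the
  characters are multiplicative: \<open>\<psi>(\<nu>) = \<psi>(\<nu> - l) * \<psi>(l)\<close>.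
\<close>

lemma convolution_theorem:
  fixes w x :: "int \<Rightarrow> int \<Rightarrow> complex" and k1 k2 :: int
  assumes P: "even P" "P > 0" and Q: "even Q" "Q > 0"
    and per: "\<And>i j a b. w (i + a * int P) (j + b * int Q) = w i j"
  defines "\<psi> \<equiv> \<lambda>\<nu>1 \<nu>2. omega P powi (- (k1 * \<nu>1)) * omega Q powi (- (k2 * \<nu>2))"
  shows "(\<Sum>\<nu>1\<in>centered P. \<Sum>\<nu>2\<in>centered Q.
      (\<Sum>l1\<in>centered P. \<Sum>l2\<in>centered Q. w (\<nu>1 - l1) (\<nu>2 - l2) * x l1 l2) * \<psi> \<nu>1 \<nu>2) =
    (\<Sum>\<nu>1\<in>centered P. \<Sum>\<nu>2\<in>centered Q. w \<nu>1 \<nu>2 * \<psi> \<nu>1 \<nu>2) *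
    (\<Sum>l1\<in>centered P. \<Sum>l2\<in>centered Q. x l1 l2 * \<psi> l1 l2)"
proof -
  let ?I = "centered P" and ?J = "centered Q"
  have split: "\<psi> \<nu>1 \<nu>2 = \<psi> (\<nu>1 - l1) (\<nu>2 - l2) * \<psi> l1 l2" for \<nu>1 \<nu>2 l1 l2
  proof -
    have "- (k * \<nu>) = - (k * (\<nu> - l)) + - (k * l)" for k \<nu> l :: int
      by (simp add: algebra_simps)
    then have "omega R powi (- (k * \<nu>)) = omega R powi (- (k * (\<nu> - l))) * omega R powi (- (k * l))"
      for R k \<nu> l using power_int_add omega_nonzero by metis
    then show ?thesis unfolding \<psi>_def by (metis (no_types, lifting) mult.assoc mult.left_commute)
  qed
  have \<psi>per: "\<psi> (i + a * int P) (j + b * int Q) = \<psi> i j" for i j a b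
  proof -
    have "- (k * (y + c * p)) = - (k * y) + (- k * c) * p" for k y c p :: int
      by (simp add: algebra_simps)
    then show ?thesis
      unfolding \<psi>_def by (simp only: omega_powi_period P Q)
  qed
  define g where "g i j = w i j * \<psi> i j" for i j
  have gper: "g (i + a * int P) (j + b * int Q) = g i j" for i j a b
    by (simp only: g_def per \<psi>per)
  have gper1: "g (i + a * int P) j = g i j" and gper2: "g i (j + a * int Q) = g i j" for i j a
    using gper[of i a j 0] gper[of i 0 j a] by simp_all
  have shift: "(\<Sum>\<nu>1\<in>?I. \<Sum>\<nu>2\<in>?J. g (\<nu>1 - l1) (\<nu>2 - l2)) = (\<Sum>\<nu>1\<in>?I. \<Sum>\<nu>2\<in>?J. g \<nu>1 \<nu>2)" for l1 l2
  proof -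
    have "(\<Sum>\<nu>1\<in>?I. \<Sum>\<nu>2\<in>?J. g (\<nu>1 - l1) (\<nu>2 - l2)) = (\<Sum>\<nu>1\<in>?I. \<Sum>\<nu>2\<in>?J. g (\<nu>1 - l1) \<nu>2)"
      by (intro sum.cong refl sum_centered_shift[OF Q]) (rule gper2)
    also have "\<dots> = (\<Sum>\<nu>1\<in>?I. \<Sum>\<nu>2\<in>?J. g \<nu>1 \<nu>2)"
      by (rule sum_centered_shift[OF P, where f = "\<lambda>i. \<Sum>\<nu>2\<in>?J. g i \<nu>2"]) (simp only: gper1)
    finally show ?thesis .
  qed
  have pair: "(\<Sum>i\<in>?I. \<Sum>j\<in>?J. h i j) = (\<Sum>p\<in>?I \<times> ?J. h (fst p) (snd p))"
    for h :: "int \<Rightarrow> int \<Rightarrow> complex"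
    by (simp only: sum.cartesian_product case_prod_unfold)
  have term_eq: "w (\<nu>1 - l1) (\<nu>2 - l2) * x l1 l2 * \<psi> \<nu>1 \<nu>2 =
      g (\<nu>1 - l1) (\<nu>2 - l2) * (x l1 l2 * \<psi> l1 l2)" for \<nu>1 \<nu>2 l1 l2
    by (simp only: g_def split[of \<nu>1 \<nu>2 l1 l2] mult_ac)
  have "(\<Sum>\<nu>1\<in>?I. \<Sum>\<nu>2\<in>?J. (\<Sum>l1\<in>?I. \<Sum>l2\<in>?J. w (\<nu>1 - l1) (\<nu>2 - l2) * x l1 l2) * \<psi> \<nu>1 \<nu>2) =
      (\<Sum>\<nu>1\<in>?I. \<Sum>\<nu>2\<in>?J. \<Sum>l1\<in>?I. \<Sum>l2\<in>?J. g (\<nu>1 - l1) (\<nu>2 - l2) * (x l1 l2 * \<psi> l1 l2))"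
    unfolding sum_distrib_right term_eq ..
  also have "\<dots> = (\<Sum>\<nu>\<in>?I \<times> ?J. \<Sum>l\<in>?I \<times> ?J.
      g (fst \<nu> - fst l) (snd \<nu> - snd l) * (x (fst l) (snd l) * \<psi> (fst l) (snd l)))"
    by (simp only: pair)
  also have "\<dots> = (\<Sum>l\<in>?I \<times> ?J. \<Sum>\<nu>\<in>?I \<times> ?J.
      g (fst \<nu> - fst l) (snd \<nu> - snd l) * (x (fst l) (snd l) * \<psi> (fst l) (snd l)))"
    by (rule sum.swap)
  also have "\<dots> = (\<Sum>l1\<in>?I. \<Sum>l2\<in>?J.
      (\<Sum>\<nu>1\<in>?I. \<Sum>\<nu>2\<in>?J. g (\<nu>1 - l1) (\<nu>2 - l2)) * (x l1 l2 * \<psi> l1 l2))"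
    by (simp only: pair sum_distrib_right)
  also have "\<dots> = (\<Sum>\<nu>1\<in>?I. \<Sum>\<nu>2\<in>?J. g \<nu>1 \<nu>2) * (\<Sum>l1\<in>?I. \<Sum>l2\<in>?J. x l1 l2 * \<psi> l1 l2)"
    by (simp only: shift sum_distrib_left)
  finally show ?thesis unfolding g_def .
qed

section \<open>The interpolated image\<close>

theorem theorem2p1:
  fixes n m N M :: nat
    and A Ah W Wc At Ath :: "complex mat"
  assumes N: "N = 2 * n" "N > 0" "8 dvd N"
    and M: "M = 2 * m" "M > 0"
    and A: "A \<in> carrier_mat N M"
    and Ah: "Ah = fourier N * A * fourier M"
    and W: "W \<in> carrier_mat n M"
    and Wc: "Wc = complex_of_real (sqrt (real (M * n))) \<cdot>\<^sub>m (fourier_inv n * W * fourier_inv M)"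
    and Ath: "Ath \<in> carrier_mat N M"
    and Ath_odd:
      "\<And>\<nu>1 \<nu>2. \<nu>1 \<in> {- (int n div 2)..<int n div 2} \<Longrightarrow> \<nu>2 \<in> {- int m..<int m} \<Longrightarrow>
         centry Ath (2 * \<nu>1 + 1) \<nu>2 = centry Ah (2 * \<nu>1 + 1) \<nu>2"
    and Ath_even:
      "\<And>\<nu>1 \<nu>2. \<nu>1 \<in> {- (int n div 2)..<int n div 2} \<Longrightarrow> \<nu>2 \<in> {- int m..<int m} \<Longrightarrow>
         centry Ath (2 * \<nu>1) \<nu>2 =
           (\<Sum>l1 \<in> {- (int n div 2)..<int n div 2}. \<Sum>l2 \<in> {- int m..<int m}.
              pentry W (\<nu>1 - l1) (\<nu>2 - l2) * centry Ah (2 * l1 + 1) l2)"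
    and At: "At = fourier_inv N * Ath * fourier_inv M"
  shows "\<forall>k1 \<in> {0..<int n}. \<forall>k2 \<in> {- int m..<int m}.
           centry At k1 k2 =
             1 / 2 * (1 + pentry Wc k1 k2 * omega N powi k1)
                   * (centry A k1 k2 - centry A (k1 - int n) k2)"
proof (intro ballI)
  fix k1 k2 :: int
  assume k1: "k1 \<in> {0..<int n}" and "k2 \<in> {- int m..<int m}"
  have evn: "even n" using N by presburger
  have n0: "n > 0" using N by simp
  have evN: "even N" and evM: "even M" using N M by simp_all
  have J: "{- int m..<int m} = centered M" using M by simp
  have k2: "k2 \<in> centered M" using \<open>k2 \<in> {- int m..<int m}\<close> J by simp
  have k1N: "k1 \<in> centered N" using k1 N by auto
  have AhC: "Ah \<in> carrier_mat N M"
    unfolding Ah by (intro mult_carrier_mat[OF mult_carrier_mat[OF _ A]] fourier_carrier)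
  have A_eq: "A = fourier_inv N * Ah * fourier_inv M"
    unfolding Ah by (rule idft2_dft2[OF N(2) M(2) A, symmetric])
  define s where "s = complex_of_real (sqrt (real (N * M)))"
  define x where "x l1 l2 = centry Ah (2 * l1 + 1) l2" for l1 l2
  define \<psi> where "\<psi> \<nu>1 \<nu>2 = omega n powi (- (k1 * \<nu>1)) * omega M powi (- (k2 * \<nu>2))" for \<nu>1 \<nu>2
  define S where "S = (\<Sum>\<nu>1\<in>centered n. \<Sum>\<nu>2\<in>centered M. x \<nu>1 \<nu>2 * \<psi> \<nu>1 \<nu>2)"
  define wc where "wc = pentry Wc k1 k2"
  have ch_even: "omega N powi (- (k1 * (2 * \<nu>))) = omega n powi (- (k1 * \<nu>))" for \<nu>
    using omega_double_powi_even[OF n0, of "- (k1 * \<nu>)"] N by (simp add: mult.left_commute)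
  have ch_odd: "omega N powi (- (k1 * (2 * \<nu> + 1))) = omega n powi (- (k1 * \<nu>)) * omega N powi (- k1)" for \<nu>
  proof -
    have "- (k1 * (2 * \<nu> + 1)) = - (k1 * (2 * \<nu>)) + - k1" by (simp add: algebra_simps)
    then have "omega N powi (- (k1 * (2 * \<nu> + 1))) = omega N powi (- (k1 * (2 * \<nu>))) * omega N powi (- k1)"
      by (simp only: power_int_add omega_nonzero simp_thms)
    then show ?thesis by (simp only: ch_even)
  qed
  have odd_rows: "(\<Sum>\<nu>1\<in>centered n. \<Sum>\<nu>2\<in>centered M. centry Ah (2 * \<nu>1 + 1) \<nu>2 *
        (omega N powi (- (k1 * (2 * \<nu>1 + 1))) * omega M powi (- (k2 * \<nu>2)))) = omega N powi (- k1) * S"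
    unfolding S_def x_def \<psi>_def ch_odd sum_distrib_left by (simp only: mult_ac)
  have diff: "centry A k1 k2 - centry A (k1 - int n) k2 = 2 * (omega N powi (- k1) * S) / s"
    using halfperiod_difference[OF evn n0 evM M(2) _ k1 k2, of Ah] AhC
    unfolding N(1)[symmetric] A_eq[symmetric] odd_rows s_def by blast
  have W_eq: "wc = (\<Sum>\<nu>1\<in>centered n. \<Sum>\<nu>2\<in>centered M. pentry W \<nu>1 \<nu>2 * \<psi> \<nu>1 \<nu>2)"
  proof -
    have "wc = (\<Sum>\<nu>1\<in>centered n. \<Sum>\<nu>2\<in>centered M. centry W \<nu>1 \<nu>2 * \<psi> \<nu>1 \<nu>2)"
      unfolding wc_def Wc \<psi>_def mult.commute[of M n]
      by (rule pentry_unnormalized_idft2[OF evn n0 evM M(2) W])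
    also have "\<dots> = (\<Sum>\<nu>1\<in>centered n. \<Sum>\<nu>2\<in>centered M. pentry W \<nu>1 \<nu>2 * \<psi> \<nu>1 \<nu>2)"
      by (intro sum.cong refl) (simp only: pentry_eq_centry[OF W evn evM])
    finally show ?thesis .
  qed
  have even_rows: "(\<Sum>\<nu>1\<in>centered n. \<Sum>\<nu>2\<in>centered M. centry Ath (2 * \<nu>1) \<nu>2 *
        (omega N powi (- (k1 * (2 * \<nu>1))) * omega M powi (- (k2 * \<nu>2)))) = wc * S"
  proof -
    have "(\<Sum>\<nu>1\<in>centered n. \<Sum>\<nu>2\<in>centered M. centry Ath (2 * \<nu>1) \<nu>2 *
        (omega N powi (- (k1 * (2 * \<nu>1))) * omega M powi (- (k2 * \<nu>2)))) =
      (\<Sum>\<nu>1\<in>centered n. \<Sum>\<nu>2\<in>centered M. (\<Sum>l1\<in>centered n. \<Sum>l2\<in>centered M.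
         pentry W (\<nu>1 - l1) (\<nu>2 - l2) * x l1 l2) * \<psi> \<nu>1 \<nu>2)"
      by (intro sum.cong refl) (simp only: Ath_even[unfolded J] ch_even x_def \<psi>_def)
    also have "\<dots> = wc * S"
      unfolding W_eq S_def \<psi>_def
      by (rule convolution_theorem[OF evn n0 evM M(2)]) (rule pentry_periodic[OF W])
    finally show ?thesis .
  qed
  have "centry At k1 k2 = (wc * S + omega N powi (- k1) * S) / s"
  proof -
    have "(\<Sum>\<nu>1\<in>centered n. \<Sum>\<nu>2\<in>centered M. centry Ath (2 * \<nu>1 + 1) \<nu>2 *
        (omega N powi (- (k1 * (2 * \<nu>1 + 1))) * omega M powi (- (k2 * \<nu>2)))) = omega N powi (- k1) * S"
      unfolding odd_rows[symmetric] by (intro sum.cong refl) (simp only: Ath_odd[unfolded J])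
    with even_rows show ?thesis
      unfolding At centry_idft2[OF evN N(2) evM M(2) Ath k1N k2] s_def
      by (simp only: N(1) sum_centered_even_odd[OF evn])
  qed
  also have "\<dots> = (1 + wc * omega N powi k1) * (omega N powi (- k1) * S / s)"
    by (simp add: power_int_minus field_simps)
  also have "\<dots> = 1 / 2 * (1 + wc * omega N powi k1) * (centry A k1 k2 - centry A (k1 - int n) k2)"
    unfolding diff by simp
  finally show "centry At k1 k2 = 1 / 2 * (1 + pentry Wc k1 k2 * omega N powi k1)
      * (centry A k1 k2 - centry A (k1 - int n) k2)" unfolding wc_def .
qed

end
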